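(* Let $2\leq m<n$ be integers. Then the resultant of $\Psi_m(x,y)$ and $\Psi_n(x,y)$ with respect to $x$ is $$\begin{cases} p^{\varphi(m)}\,y^{\varphi(m)\varphi(n)}&\text{if } n/m=p^\alpha \text{ for some prime } p \text{ and some positive integer } \alpha;\\ y^{\varphi(m)\varphi(n)}&\text{otherwise}. \end{cases}$$
   Context: The Fibonacci polynomials are defined by $F_1(x)=1$, $F_2(x)=x$, and $F_n(x)=xF_{n-1}(x)+F_{n-2}(x)$ for $n\geq 3$. For $n\geq 2$, the $n$-th fibotomic polynomial $\Psi_n(x)\in\mathbb{Z}[x]$ is the product of the monic irreducible factors of $F_n(x)$ which are not factors of $F_k(x)$ for any $k<n$; also $\Psi_1(x)=1$. Thus $F_n(x)=\prod_{d\mid n}\Psi_d(x)$ for all $n\geq1$, and for $n\geq 2$, $\Psi_n(x)$ is monic of degree $\varphi(n)$, where $\varphi$ is Euler's totient function. The homogenized fibotomic polynomials are $\Psi_1(x,y)=1$ and $\Psi_n(x,y)=y^{\varphi(n)}\Psi_n(x/y)$ for $n\geq2$; these are homogeneous of degree $\varphi(n)$ and monic in $x$. For monic polynomials $f,g$ (in $x$) with roots $a_1,\dots,a_r$ and $b_1,\dots,b_s$ respectively, the resultant is $\textup{res}(f,g)=\prod_{i,j}(a_i-b_j)$. *)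

theory Defs
  imports "HOL-Computational_Algebra.Polynomial_Factorial"
          "HOL-Number_Theory.Number_Theory"
          "Subresultants.Resultant_Prelim"
begin

(* Fibonacci polynomials: F_1 = 1, F_2 = x, F_n = x F_{n-1} + F_{n-2};
   F_0 = 0 is only an auxiliary value (consistent with the recursion). *)
fun fib_poly :: "nat \<Rightarrow> int poly" where
  "fib_poly 0 = 0"
| "fib_poly (Suc 0) = 1"
| "fib_poly (Suc (Suc n)) = [:0, 1:] * fib_poly (Suc n) + fib_poly n"

definition fibotomic :: "nat \<Rightarrow> int poly" where
  "fibotomic n = (if n \<le> 1 then 1 else
     \<Prod> {p. monic p \<and> irreducible p \<and> p dvd fib_poly n \<and>
            (\<forall>k\<in>{1..<n}. \<not> p dvd fib_poly k)})"

(* Homogenized fibotomic polynomial Psi_n(x,y) = y^phi(n) Psi_n(x/y), represented as a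
   polynomial in x whose coefficients are polynomials in y (int poly poly). *)
definition hom_fibotomic :: "nat \<Rightarrow> int poly poly" where
  "hom_fibotomic n = (if n \<le> 1 then 1 else
     (\<Sum>i\<le>totient n. monom (monom (coeff (fibotomic n) i) (totient n - i)) i))"

end

theory Submission
  imports Defs "Subresultants.Subresultant"
    "HOL-Computational_Algebra.Fundamental_Theorem_Algebra"
    "HOL-Computational_Algebra.Squarefree"
begin

text \<open>
  For monic \<open>f\<close> the resultant of \<open>f\<close> and \<open>g\<close> is the product of the values of \<open>g\<close> at the roots of
  \<open>f\<close>, because both sides obey the same Euclidean recursion. Hence it is multiplicative in \<open>g\<close>,
  depends only on \<open>g\<close> modulo \<open>f\<close>, and is a unit when \<open>f\<close> and \<open>g\<close> generate the unit ideal.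
  Homogenization multiplies every term of the Sylvester determinant by the same power of \<open>y\<close>.

  The ideal \<open>(F\<^sub>m, F\<^sub>n)\<close> is \<open>(F\<^sub>g)\<close> with \<open>g = gcd m n\<close>. Dividing by \<open>F\<^sub>g\<close> shows that \<open>\<Psi>\<^sub>m\<close> and
  \<open>\<Psi>\<^sub>n\<close> are comaximal if neither index divides the other. The congruence
  \<open>F\<^sub>k\<^sub>m / F\<^sub>m \<equiv> k F\<^sub>m\<^sub>+\<^sub>1\<^sup>k\<^sup>-\<^sup>1\<close> modulo \<open>F\<^sub>m\<close> then gives that the product of
  \<open>\<bar>res(\<Psi>\<^sub>m, \<Psi>\<^sub>m\<^sub>e)\<bar>\<close> over the divisors \<open>e > 1\<close> of \<open>k\<close> is \<open>k\<close> to the power \<open>\<phi>(m)\<close>. Comparing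
  logarithms with \<open>ln k = \<Sum>\<Lambda>(e)\<close> (sum over \<open>e dvd k\<close>) identifies each factor with
  \<open>exp (\<phi>(m) \<Lambda>(e))\<close>.

  The resultant is not negative because \<open>\<Psi>\<^sub>n\<close> has no real root for \<open>n \<ge> 3\<close>: its roots come in
  conjugate pairs, at which \<open>\<Psi>\<^sub>m\<close> takes conjugate values.
\<close>

subsection \<open>Resultants and roots\<close>

lemma resultant_mod_right:
  fixes f g :: "'a :: field poly"
  shows "resultant f g = lead_coeff f ^ (degree g - degree (g mod f)) * resultant f (g mod f)"
proof -
  define r where "r = g mod f"
  have division: "g + - (g div f) * f = r"
    by (simp add: r_def minus_div_mult_eq_mod flip: diff_conv_add_uminus)
  consider (trivial) "f = 0 \<or> degree g < degree f" | (nonzero_const) "degree f = 0" "f \<noteq> 0"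
    | (proper) "degree r < degree f" "degree f \<le> degree g"
    using degree_mod_less'[of f g] by (cases "r = 0") (force simp: r_def)+
  then show ?thesis
  proof cases
    case trivial
    then show ?thesis by (auto simp: mod_poly_less)
  next
    case nonzero_const
    then obtain c where c: "f = [:c:]" by (blast elim: degree_eq_zeroE)
    then have "g mod f = 0"
      using nonzero_const by (intro unit_imp_mod_eq_0) (simp add: is_unit_const_poly_iff dvd_field_iff)
    then show ?thesis using c by simp
  next
    case proper
    have "resultant g f =
        (- 1) ^ (degree g * degree f) * (lead_coeff f ^ (degree g - degree r) * resultant f r)"
    proof (cases "degree r = 0")
      case True
      then obtain c where c: "r = [:c:]" by (rule degree_eq_zeroE)
      have "subresultant 0 g f = smult ((- 1) ^ (degree g * degree f) * lead_coeff f ^ degree g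
          * lead_coeff r ^ (degree f - 1)) r"
        using BT_lemma_1_13[OF division] proper True by simp
      then show ?thesis
        using proper c by (simp add: subresultant_resultant flip: power_Suc2)
    next
      case False
      then show ?thesis
        using BT_lemma_1_12[OF division, of 0] proper by (simp add: subresultant_resultant)
    qed
    then show ?thesis
      unfolding resultant_swap[of f g] by (simp add: r_def mult.commute[of "degree f"])
  qed
qed

lemma
  fixes p :: "'a :: alg_closed_field poly"
  shows alg_closed_poly_decompose_proots: "smult (lead_coeff p) (\<Prod>a\<in>#proots p. [:- a, 1:]) = p"
    and alg_closed_size_proots: "size (proots p) = degree p"
proof -
  have "smult (lead_coeff p) (\<Prod>a\<in>#proots p. [:- a, 1:]) = p \<and> size (proots p) = degree p"
  proof (cases "p = 0")
    case False
    then obtain A where A: "size A = degree p" "p = smult (lead_coeff p) (\<Prod>a\<in>#A. [:- a, 1:])"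
      using alg_closed_imp_factorization by blast
    have "proots (\<Prod>a\<in>#A. [:- a, 1:]) = A"
    proof (induction A)
      case (add a A)
      have "(\<Prod>a\<in>#A. [:- a, 1:]) \<noteq> 0" by auto
      then show ?case
        using add proots_linear_factor[of "- a"] by (simp add: proots_mult del: mult_pCons_left)
    qed simp
    then have "proots p = A"
      using False by (subst A(2)) simp
    with A show ?thesis by simp
  qed simp
  then show "smult (lead_coeff p) (\<Prod>a\<in>#proots p. [:- a, 1:]) = p" "size (proots p) = degree p"
    by blast+
qed

lemma alg_closed_poly_eq_prod_proots:
  fixes p :: "'a :: alg_closed_field poly"
  shows "poly p x = lead_coeff p * (\<Prod>a\<in>#proots p. x - a)"
proof -
  have "poly p x = poly (smult (lead_coeff p) (\<Prod>a\<in>#proots p. [:- a, 1:])) x"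
    by (simp only: alg_closed_poly_decompose_proots)
  also have "\<dots> = lead_coeff p * (\<Prod>a\<in>#proots p. x - a)"
    by (simp add: poly_prod_mset)
  finally show ?thesis .
qed

lemma prod_proots_poly_swap:
  fixes f g :: "'a :: alg_closed_field poly"
  shows "lead_coeff f ^ degree g * (\<Prod>a\<in>#proots f. poly g a) =
    (- 1) ^ (degree f * degree g) * (lead_coeff g ^ degree f * (\<Prod>b\<in>#proots g. poly f b))"
proof -
  have "(\<Prod>a\<in>#proots f. poly g a) = lead_coeff g ^ degree f * (\<Prod>a\<in>#proots f. \<Prod>b\<in>#proots g. a - b)"
    by (simp add: alg_closed_poly_eq_prod_proots[of g] prod_mset.distrib alg_closed_size_proots)
  also have "(\<Prod>a\<in>#proots f. \<Prod>b\<in>#proots g. a - b) = (\<Prod>b\<in>#proots g. \<Prod>a\<in>#proots f. - 1 * (b - a))"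
    by (subst prod_mset.swap) simp
  also have "\<dots> = (- 1) ^ (degree f * degree g) * (\<Prod>b\<in>#proots g. \<Prod>a\<in>#proots f. b - a)"
    by (simp only: prod_mset.distrib prod_mset_constant alg_closed_size_proots power_mult)
  finally show ?thesis
    by (simp add: alg_closed_poly_eq_prod_proots[of f] prod_mset.distrib alg_closed_size_proots)
qed

lemma resultant_eq_prod_proots:
  fixes f g :: "'a :: alg_closed_field poly"
  shows "resultant f g = lead_coeff f ^ degree g * (\<Prod>a\<in>#proots f. poly g a)"
proof (induction "degree f" arbitrary: f g rule: less_induct)
  case less
  show ?case
  proof (cases "degree f = 0")
    case True
    then obtain c where "f = [:c:]" by (rule degree_eq_zeroE)
    then show ?thesis by simp
  next
    case False
    then have "f \<noteq> 0" by auto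
    define r where "r = g mod f"
    have roots: "(\<Prod>a\<in>#proots f. poly r a) = (\<Prod>a\<in>#proots f. poly g a)"
      using \<open>f \<noteq> 0\<close>
      by (intro arg_cong[of _ _ prod_mset] image_mset_cong) (simp add: r_def poly_mod)
    have "degree r < degree f"
      using degree_mod_less'[of f g] False \<open>f \<noteq> 0\<close> by (cases "r = 0") (auto simp: r_def)
    then have "resultant f r = lead_coeff f ^ degree r * (\<Prod>a\<in>#proots f. poly r a)"
      unfolding prod_proots_poly_swap[of f r] resultant_swap[of f r]
      using less.hyps[of r f] by simp
    then have "resultant f g =
        lead_coeff f ^ (degree g - degree r) * lead_coeff f ^ degree r * (\<Prod>a\<in>#proots f. poly g a)"
      using resultant_mod_right[of f g] by (simp add: r_def[symmetric] roots)
    also have "lead_coeff f ^ (degree g - degree r) * lead_coeff f ^ degree r =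
        lead_coeff f ^ degree g"
      using \<open>degree r < degree f\<close>
      by (cases "degree g < degree f") (simp_all add: r_def mod_poly_less flip: power_add)
    finally show ?thesis .
  qed
qed

definition comaximal :: "'a :: comm_semiring_1 \<Rightarrow> 'a \<Rightarrow> bool" where
  "comaximal a b \<longleftrightarrow> (\<exists>u v. u * a + v * b = 1)"

lemma comaximal_mono:
  assumes "comaximal a b" and "a' dvd a" and "b' dvd b"
  shows "comaximal a' b'"
proof -
  obtain u v where "u * a + v * b = 1" using assms(1) unfolding comaximal_def by blast
  moreover obtain s t where "a = a' * s" "b = b' * t" using assms(2,3) by (meson dvdE)
  ultimately have "(u * s) * a' + (v * t) * b' = 1" by (simp add: mult_ac)
  then show ?thesis unfolding comaximal_def by blast
qed

lemma comaximal_dvd_multD: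
  fixes a b c :: "'a :: comm_ring_1"
  assumes "comaximal a b" and "a dvd c * b"
  shows "a dvd c"
proof -
  obtain u v where "u * a + v * b = 1" using assms(1) unfolding comaximal_def by blast
  then have "c = (c * u) * a + v * (c * b)"
    by (metis distrib_left mult.assoc mult.left_commute mult.right_neutral)
  then show ?thesis using assms(2) by (metis dvd_add dvd_mult dvd_triv_right)
qed

text \<open>
  The embedding only supplies the roots of \<open>f\<close>. Every integral domain has one, into the algebraic
  closure of its field of fractions.
\<close>
locale alg_closed_embedding = inj_comm_ring_hom hom
  for hom :: "'a :: idom \<Rightarrow> 'b :: alg_closed_field"
begin

sublocale map_poly_hom: map_poly_inj_comm_ring_hom hom ..

lemma hom_resultant_monic:
  fixes f g :: "'a poly"
  assumes "monic f"
  shows "hom (resultant f g) = (\<Prod>a\<in>#proots (map_poly hom f). poly (map_poly hom g) a)"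
  unfolding resultant_hom[symmetric] resultant_eq_prod_proots using assms by simp

lemma resultant_mult_right:
  fixes f g h :: "'a poly"
  assumes "monic f"
  shows "resultant f (g * h) = resultant f g * resultant f h"
proof -
  have "hom (resultant f (g * h)) = hom (resultant f g * resultant f h)"
    by (simp add: hom_resultant_monic[OF assms] hom_mult map_poly_hom.hom_mult prod_mset.distrib)
  then show ?thesis by simp
qed

lemma resultant_power_right:
  fixes f g :: "'a poly"
  assumes "monic f"
  shows "resultant f (g ^ k) = resultant f g ^ k"
  by (induction k) (simp_all add: resultant_mult_right[OF assms])

lemma resultant_prod_right:
  fixes f :: "'a poly"
  assumes "monic f"
  shows "resultant f (\<Prod>i\<in>I. g i) = (\<Prod>i\<in>I. resultant f (g i))"
  by (induction I rule: infinite_finite_induct) (simp_all add: resultant_mult_right[OF assms])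

lemma resultant_cong_right:
  fixes f g h :: "'a poly"
  assumes "monic f" and "f dvd g - h"
  shows "resultant f g = resultant f h"
proof -
  obtain q where "g - h = f * q" using assms(2) by blast
  then have g: "g = f * q + h" by (simp add: algebra_simps)
  have "poly (map_poly hom g) a = poly (map_poly hom h) a" if "a \<in># proots (map_poly hom f)" for a
    using that by (cases "f = 0") (auto simp: g map_poly_hom.hom_add map_poly_hom.hom_mult)
  then have "hom (resultant f g) = hom (resultant f h)"
    unfolding hom_resultant_monic[OF assms(1)]
    by (intro arg_cong[of _ _ prod_mset] image_mset_cong)
  then show ?thesis by simp
qed

lemma is_unit_resultant_comaximal:
  fixes f g :: "'a poly"
  assumes "monic f" and "comaximal f g"
  shows "resultant f g dvd 1"
proof -
  obtain u v where "u * f + v * g = 1" using assms(2) unfolding comaximal_def by blast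
  then have "f dvd v * g - 1"
    by (intro dvdI[of _ _ "- u"]) (simp add: algebra_simps)
  then have "resultant f v * resultant f g = 1"
    using resultant_cong_right[OF assms(1), of "v * g" 1] resultant_mult_right[OF assms(1), of v g]
    by simp
  then show ?thesis by (intro dvdI[of _ _ "resultant f v"]) (simp add: mult.commute)
qed

end

interpretation of_int_complex: alg_closed_embedding "of_int :: int \<Rightarrow> complex" ..

lemma abs_resultant_comaximal:
  fixes f g :: "int poly"
  assumes "monic f" and "comaximal f g"
  shows "\<bar>resultant f g\<bar> = 1"
  using of_int_complex.is_unit_resultant_comaximal[OF assms] by simp

lemma proots_conjugate_pairs:
  fixes p :: "real poly"
  assumes "\<And>x. poly p x \<noteq> 0"
  obtains A where "proots (map_poly complex_of_real p) = A + image_mset cnj A"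
proof -
  define P where "P = map_poly complex_of_real p"
  interpret map_poly_cnj: map_poly_inj_idom_divide_hom cnj by unfold_locales auto
  have "p \<noteq> 0" using assms[of 0] by auto
  then have "P \<noteq> 0" by (simp add: P_def)
  have P_cnj: "map_poly cnj P = P" by (simp add: P_def map_poly_map_poly o_def)
  have order_cnj: "order (cnj z) P = order z P" for z
    using map_poly_cnj.order_hom[of z P] by (simp add: P_cnj)
  have non_real: "order z P = 0" if "Im z = 0" for z
  proof -
    have "z = of_real (Re z)" using that by (simp add: complex_eq_iff)
    then have "poly P z \<noteq> 0"
      unfolding P_def by (metis assms of_real_eq_0_iff of_real_hom.poly_map_poly)
    then show ?thesis by (rule order_0I)
  qed
  define A where "A = filter_mset (\<lambda>z. Im z > 0) (proots P)"
  have "proots P = A + image_mset cnj A"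
  proof (rule multiset_eqI)
    fix z
    have "count (image_mset cnj A) z = count A (cnj z)"
      by (induction A) auto
    then show "count (proots P) z = count (A + image_mset cnj A) z"
      using \<open>P \<noteq> 0\<close> non_real[of z] by (auto simp: A_def order_cnj)
  qed
  then show ?thesis using that unfolding P_def by blast
qed

lemma resultant_nonneg_if_no_real_root:
  fixes f g :: "real poly"
  assumes "lead_coeff g \<ge> 0" and "\<And>x. poly g x \<noteq> 0"
  shows "resultant f g \<ge> 0"
proof -
  define F where "F = map_poly complex_of_real f"
  define G where "G = map_poly complex_of_real g"
  obtain A where A: "proots G = A + image_mset cnj A"
    using proots_conjugate_pairs[OF assms(2)] unfolding G_def by blast
  have "degree G = size A + size A"
    using alg_closed_size_proots[of G] by (simp add: A)
  then have "even (degree G)" by simp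
  have "(\<Prod>b\<in>#image_mset cnj A. poly F b) = cnj (\<Prod>b\<in>#A. poly F b)"
    unfolding F_def by (induction A) (simp_all add: poly_cnj_real)
  then have prod_conjugates: "(\<Prod>b\<in>#proots G. poly F b) = of_real ((cmod (\<Prod>b\<in>#A. poly F b))\<^sup>2)"
    unfolding A by (simp add: complex_norm_square del: of_real_power)
  have "complex_of_real (resultant f g) = resultant F G"
    by (simp add: F_def G_def of_real_hom.resultant_hom)
  also have "\<dots> = lead_coeff G ^ degree F * (\<Prod>b\<in>#proots G. poly F b)"
    using \<open>even (degree G)\<close> by (subst resultant_swap) (simp add: resultant_eq_prod_proots)
  also have "\<dots> = of_real (lead_coeff g ^ degree f * (cmod (\<Prod>b\<in>#A. poly F b))\<^sup>2)"
    unfolding prod_conjugates by (simp add: F_def G_def)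
  finally show ?thesis
    unfolding of_real_eq_iff using assms(1) by simp
qed

subsection \<open>Homogenization\<close>

definition homogenize :: "'a :: comm_ring_1 poly \<Rightarrow> 'a poly poly" where
  "homogenize f = (\<Sum>i\<le>degree f. monom (monom (coeff f i) (degree f - i)) i)"

lemma coeff_homogenize: "coeff (homogenize f) i = monom (coeff f i) (degree f - i)"
  by (cases "i \<le> degree f") (auto simp: homogenize_def coeff_sum coeff_eq_0)

lemma degree_homogenize: "degree (homogenize f) = degree f"
proof (rule antisym)
  show "degree (homogenize f) \<le> degree f"
    by (intro degree_le) (simp add: coeff_homogenize coeff_eq_0)
  show "degree f \<le> degree (homogenize f)"
  proof (cases "f = 0")
    case False
    then show ?thesis by (intro le_degree) (simp add: coeff_homogenize monom_eq_0_iff)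
  qed simp
qed

lemma prod_monom: "(\<Prod>i\<in>I. monom (c i) (e i)) = monom (\<Prod>i\<in>I. c i) (\<Sum>i\<in>I. e i)"
  for c :: "'b \<Rightarrow> 'a :: comm_semiring_1"
  by (induction I rule: infinite_finite_induct) (simp_all add: mult_monom monom_0)

lemma det_monom_weights:
  fixes A :: "'a :: comm_ring_1 mat" and r c :: "nat \<Rightarrow> nat"
  assumes A: "A \<in> carrier_mat n n" and B: "B \<in> carrier_mat n n"
    and entries: "\<And>i j. i < n \<Longrightarrow> j < n \<Longrightarrow> B $$ (i, j) = monom (A $$ (i, j)) (e i j)"
    and weights: "\<And>i j. i < n \<Longrightarrow> j < n \<Longrightarrow> A $$ (i, j) \<noteq> 0 \<Longrightarrow> e i j + r i = c j"
    and total: "w + (\<Sum>i<n. r i) = (\<Sum>j<n. c j)"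
  shows "det B = monom (det A) w"
proof -
  have permutation_term: "(\<Prod>i<n. B $$ (i, \<pi> i)) = monom (\<Prod>i<n. A $$ (i, \<pi> i)) w"
    if \<pi>: "\<pi> permutes {..<n}" for \<pi>
  proof -
    have less: "\<pi> i < n" if "i < n" for i
      using permutes_in_image[OF \<pi>, of i] that by simp
    have "(\<Prod>i<n. B $$ (i, \<pi> i)) = monom (\<Prod>i<n. A $$ (i, \<pi> i)) (\<Sum>i<n. e i (\<pi> i))"
      unfolding prod_monom[symmetric] using less by (intro prod.cong) (simp_all add: entries)
    moreover have "(\<Sum>i<n. e i (\<pi> i)) = w" if nonzero: "(\<Prod>i<n. A $$ (i, \<pi> i)) \<noteq> 0"
    proof -
      have "A $$ (i, \<pi> i) \<noteq> 0" if "i < n" for i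
        using nonzero that by (metis finite_lessThan lessThan_iff prod_zero)
      then have "(\<Sum>i<n. e i (\<pi> i)) + (\<Sum>i<n. r i) = (\<Sum>i<n. c (\<pi> i))"
        using less by (simp add: weights flip: sum.distrib)
      also have "\<dots> = (\<Sum>j<n. c j)"
        using sum.permute[OF \<pi>, of c] by (simp add: o_def)
      finally show ?thesis by (simp flip: total)
    qed
    ultimately show ?thesis by (cases "(\<Prod>i<n. A $$ (i, \<pi> i)) = 0") simp_all
  qed
  have "det B = (\<Sum>\<pi> | \<pi> permutes {..<n}. signof \<pi> * (\<Prod>i<n. B $$ (i, \<pi> i)))"
    by (simp add: det_def'[OF B] atLeast0LessThan)
  also have "\<dots> = (\<Sum>\<pi> | \<pi> permutes {..<n}. monom (signof \<pi> * (\<Prod>i<n. A $$ (i, \<pi> i))) w)"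
    by (intro sum.cong) (auto simp: permutation_term sign_def minus_monom)
  also have "\<dots> = monom (det A) w"
    by (simp add: det_def'[OF A] atLeast0LessThan monom_sum)
  finally show ?thesis .
qed

lemma resultant_homogenize:
  fixes f g :: "'a :: comm_ring_1 poly"
  shows "resultant (homogenize f) (homogenize g) = monom (resultant f g) (degree f * degree g)"
proof -
  define r where "r i = (if i < degree g then i else i - degree g)" for i
  let ?n = "degree f + degree g"
  show ?thesis
    unfolding resultant_def
  proof (rule det_monom_weights[where r = r and c = "\<lambda>j. j" and e = "\<lambda>i j. j - r i"])
    show "sylvester_mat f g \<in> carrier_mat ?n ?n"
      "sylvester_mat (homogenize f) (homogenize g) \<in> carrier_mat ?n ?n"
      by (auto simp: degree_homogenize intro!: carrier_matI)
    show "degree f * degree g + (\<Sum>i<?n. r i) = \<Sum>{..<?n}"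
    proof -
      have split: "(\<Sum>i<a + b. h i) = (\<Sum>i<b. h i) + (\<Sum>i<a. h (i + b))"
        for a b and h :: "nat \<Rightarrow> nat"
        by (induction a) (simp_all add: add.commute)
      have "(\<Sum>i<?n. r i) = \<Sum>{..<degree g} + \<Sum>{..<degree f}"
        by (subst split) (simp add: r_def)
      moreover have "\<Sum>{..<?n} = \<Sum>{..<degree g} + \<Sum>{..<degree f} + degree f * degree g"
        by (subst split) (simp add: sum.distrib)
      ultimately show ?thesis by simp
    qed
  next
    fix i j assume "i < ?n" "j < ?n"
    then show "sylvester_mat (homogenize f) (homogenize g) $$ (i, j) =
        monom (sylvester_mat f g $$ (i, j)) (j - r i)"
      by (auto simp: r_def sylvester_index_mat degree_homogenize coeff_homogenize add.commute)
  next
    fix i j assume "i < ?n" "j < ?n" "sylvester_mat f g $$ (i, j) \<noteq> 0"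
    then show "j - r i + r i = j"
      by (auto simp: r_def sylvester_index_mat split: if_splits)
  qed
qed

subsection \<open>Fibonacci polynomials\<close>

lemma fib_poly_add:
  "fib_poly (Suc (a + b)) = fib_poly (Suc a) * fib_poly (Suc b) + fib_poly a * fib_poly b"
  by (induction a rule: fib_poly.induct) (simp_all add: algebra_simps del: mult_pCons_left)

lemma comaximal_fib_poly_Suc: "comaximal (fib_poly n) (fib_poly (Suc n))"
proof (induction n)
  case 0
  show ?case unfolding comaximal_def by (intro exI[of _ 0] exI[of _ 1]) simp
next
  case (Suc n)
  then obtain u v where "u * fib_poly n + v * fib_poly (Suc n) = 1"
    unfolding comaximal_def by blast
  then have "(v - u * [:0, 1:]) * fib_poly (Suc n) + u * fib_poly (Suc (Suc n)) = 1"
    by (simp add: algebra_simps del: mult_pCons_left mult_pCons_right)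
  then show ?case unfolding comaximal_def by blast
qed

lemma fib_poly_bezout_add:
  assumes "\<exists>u v. u * fib_poly a + v * fib_poly b = h"
  shows "\<exists>u v. u * fib_poly a + v * fib_poly (a + b) = h"
proof (cases a)
  case 0
  with assms show ?thesis by simp
next
  case (Suc l)
  obtain u v where uv: "u * fib_poly a + v * fib_poly b = h" using assms by blast
  obtain s t where st: "s * fib_poly l + t * fib_poly a = 1"
    using comaximal_fib_poly_Suc[of l] unfolding comaximal_def Suc by blast
  have "fib_poly (a + b) = fib_poly a * fib_poly (Suc b) + fib_poly l * fib_poly b"
    using fib_poly_add[of l b] by (simp add: Suc)
  then have "(u - v * s * fib_poly (Suc b) + v * t * fib_poly b) * fib_poly a
      + (v * s) * fib_poly (a + b) =
      u * fib_poly a + v * fib_poly b * (s * fib_poly l + t * fib_poly a)"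
    by (simp add: algebra_simps)
  also have "\<dots> = h" by (simp add: st uv)
  finally show ?thesis by blast
qed

lemma fib_poly_bezout: "\<exists>u v. u * fib_poly a + v * fib_poly b = fib_poly (gcd a b)"
proof (induction "a + b" arbitrary: a b rule: less_induct)
  case less
  consider (left_zero) "a = 0" | (right_zero) "b = 0"
    | (right_larger) c where "0 < a" "b = a + c" | (left_larger) c where "0 < b" "a = b + c"
    using nat_le_linear[of a b] by (force simp: le_iff_add)
  then show ?case
  proof cases
    case right_larger
    then show ?thesis using less[of a c] fib_poly_bezout_add[of a c] by simp
  next
    case left_larger
    then have "\<exists>u v. u * fib_poly b + v * fib_poly a = fib_poly (gcd a b)"
      using less[of b c] fib_poly_bezout_add[of b c] by (simp add: gcd.commute)
    then show ?thesis by (metis add.commute)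
  qed (auto intro!: exI[of _ 1])
qed

lemma dvd_fib_poly_gcd:
  assumes "p dvd fib_poly a" and "p dvd fib_poly b"
  shows "p dvd fib_poly (gcd a b)"
  using assms fib_poly_bezout[of a b] by (metis dvd_add dvd_mult)

lemma fib_poly_Suc_mult_cong: "fib_poly m dvd fib_poly (Suc (k * m)) - fib_poly (Suc m) ^ k"
proof (induction k)
  case (Suc k)
  have "fib_poly (Suc (Suc k * m)) - fib_poly (Suc m) ^ Suc k =
      (fib_poly (Suc (k * m)) - fib_poly (Suc m) ^ k) * fib_poly (Suc m)
      + fib_poly (k * m) * fib_poly m"
    using fib_poly_add[of "k * m" m] by (simp add: algebra_simps)
  then show ?case using Suc.IH by simp
qed simp

lemma fib_poly_mult_quotient:
  obtains q where "fib_poly (k * m) = fib_poly m * q"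
    and "fib_poly m dvd q - of_nat k * fib_poly (Suc m) ^ (k - 1)"
proof (cases m)
  case 0
  then show ?thesis using that[of "of_nat k * fib_poly (Suc m) ^ (k - 1)"] by simp
next
  case (Suc l)
  define residue where "residue k = of_nat k * fib_poly (Suc m) ^ (k - 1)" for k
  have residue_Suc: "residue (Suc k) = fib_poly (Suc m) ^ k + residue k * fib_poly (Suc m)" for k
    by (cases k) (simp_all add: residue_def algebra_simps)
  have "\<exists>q. fib_poly (k * m) = fib_poly m * q \<and> fib_poly m dvd q - residue k"
  proof (induction k)
    case 0
    show ?case by (auto simp: residue_def intro!: exI[of _ 0])
  next
    case (Suc k)
    then obtain q where q: "fib_poly (k * m) = fib_poly m * q" "fib_poly m dvd q - residue k"
      by blast
    have "fib_poly (Suc k * m) = fib_poly (Suc (k * m + l))"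
      by (simp add: \<open>m = Suc l\<close> algebra_simps del: fib_poly.simps)
    also have "\<dots> = fib_poly m * (fib_poly (Suc (k * m)) + q * fib_poly l)"
      unfolding fib_poly_add q(1) by (simp add: \<open>m = Suc l\<close> algebra_simps)
    finally have quotient: "fib_poly (Suc k * m) =
        fib_poly m * (fib_poly (Suc (k * m)) + q * fib_poly l)" .
    have decomposition: "fib_poly (Suc (k * m)) + q * fib_poly l - residue (Suc k) =
        (fib_poly (Suc (k * m)) - fib_poly (Suc m) ^ k) + (q - residue k) * fib_poly l
        - residue k * [:0, 1:] * fib_poly m"
      by (simp add: residue_Suc \<open>m = Suc l\<close> algebra_simps del: mult_pCons_left mult_pCons_right)
    have "fib_poly m dvd fib_poly (Suc (k * m)) + q * fib_poly l - residue (Suc k)"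
      unfolding decomposition
      by (rule dvd_diff[OF dvd_add[OF fib_poly_Suc_mult_cong dvd_mult2[OF q(2)]] dvd_triv_right])
    with quotient show ?case by blast
  qed
  then show ?thesis using that unfolding residue_def by blast
qed

lemma fib_poly_dvd:
  assumes "m dvd n"
  shows "fib_poly m dvd fib_poly n"
proof -
  obtain k where "n = k * m" using assms by (metis dvd_def mult.commute)
  then show ?thesis using fib_poly_mult_quotient[of k m] by (metis dvdI)
qed

lemma degree_fib_poly_Suc: "degree (fib_poly (Suc n)) = n"
  and monic_fib_poly_Suc: "monic (fib_poly (Suc n))"
proof -
  have "degree (fib_poly (Suc n)) \<le> n \<and> coeff (fib_poly (Suc n)) n = 1"
  proof (induction n rule: fib_poly.induct)
    case (3 n)
    have "degree (fib_poly (Suc (Suc (Suc n)))) \<le> Suc (Suc n)"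
      unfolding fib_poly.simps(3)[of "Suc n"] using 3
      by (intro degree_add_le) (auto intro: order.trans[OF degree_pCons_le])
    moreover have "coeff (fib_poly (Suc n)) (Suc (Suc n)) = 0"
      using 3 by (intro coeff_eq_0) auto
    ultimately show ?case
      using 3 by (simp add: fib_poly.simps(3)[of "Suc n"] del: fib_poly.simps(3))
  qed auto
  moreover from this show "degree (fib_poly (Suc n)) = n"
    by (intro antisym le_degree) auto
  ultimately show "monic (fib_poly (Suc n))" by simp
qed

lemma degree_fib_poly: "degree (fib_poly n) = n - 1"
  by (cases n) (simp_all add: degree_fib_poly_Suc del: fib_poly.simps(3))

lemma monic_fib_poly: "n > 0 \<Longrightarrow> monic (fib_poly n)"
  by (cases n) (simp_all add: monic_fib_poly_Suc del: fib_poly.simps(3))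

lemma fib_poly_nonzero: "n > 0 \<Longrightarrow> fib_poly n \<noteq> 0"
  using monic_fib_poly[of n] by auto

text \<open>
  Comes from differentiating \<open>F\<^sub>n = (\<alpha>\<^sup>n - \<beta>\<^sup>n) / (\<alpha> - \<beta>)\<close> with \<open>\<alpha> + \<beta> = x\<close> and \<open>\<alpha> \<beta> = - 1\<close>, so
  that \<open>(\<alpha> - \<beta>)\<^sup>2 = x\<^sup>2 + 4\<close>.
\<close>
lemma pderiv_fib_poly:
  "[:4, 0, 1:] * pderiv (fib_poly n) =
    of_nat (2 * n) * fib_poly (Suc n) - of_nat (n + 1) * [:0, 1:] * fib_poly n"
proof (induction n rule: fib_poly.induct)
  case (3 n)
  define X :: "int poly" where "X = [:0, 1:]"
  define D :: "int poly" where "D = [:4, 0, 1:]"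
  define N :: "int poly" where "N = of_nat n"
  have D_eq: "D = X * X + 4"
    by (simp add: X_def D_def numeral_poly)
  have recurrence: "fib_poly (Suc (Suc k)) = X * fib_poly (Suc k) + fib_poly k" for k
    by (simp add: X_def)
  have IH: "D * pderiv (fib_poly (Suc n)) =
      (2 * N + 2) * fib_poly (Suc (Suc n)) - (N + 2) * X * fib_poly (Suc n)"
    "D * pderiv (fib_poly n) = 2 * N * fib_poly (Suc n) - (N + 1) * X * fib_poly n"
    using 3 by (simp_all add: X_def D_def N_def algebra_simps
        del: fib_poly.simps mult_pCons_left mult_pCons_right)
  have "pderiv (fib_poly (Suc (Suc n))) =
      fib_poly (Suc n) + X * pderiv (fib_poly (Suc n)) + pderiv (fib_poly n)"
    by (simp add: X_def pderiv_add pderiv_pCons)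
  then have "D * pderiv (fib_poly (Suc (Suc n))) = D * fib_poly (Suc n)
      + X * (D * pderiv (fib_poly (Suc n))) + D * pderiv (fib_poly n)"
    by (simp add: algebra_simps)
  also have "\<dots> =
      (2 * N + 4) * fib_poly (Suc (Suc (Suc n))) - (N + 3) * X * fib_poly (Suc (Suc n))"
    unfolding IH unfolding recurrence[of "Suc n"] recurrence[of n] D_eq
    by (simp add: algebra_simps del: fib_poly.simps)
  finally show ?case
    by (simp add: X_def D_def N_def algebra_simps
        del: fib_poly.simps mult_pCons_left mult_pCons_right)
qed (simp_all add: pderiv_1)

lemma is_unit_if_dvd_monic_and_const:
  fixes p q :: "'a :: idom_divide poly"
  assumes "p dvd q" and "monic q" and "p dvd [:c:]" and "c \<noteq> 0"
  shows "is_unit p"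
proof -
  have "degree p = 0" using dvd_imp_degree_le[OF assms(3)] assms(4) by simp
  then obtain d where d: "p = [:d:]" by (rule degree_eq_zeroE)
  have "d dvd lead_coeff q" using assms(1) unfolding d const_poly_dvd_iff by blast
  then show ?thesis using assms(2) by (simp add: d is_unit_const_poly_iff)
qed

lemma squarefree_fib_poly:
  assumes "n > 0"
  shows "squarefree (fib_poly n)"
proof (rule squarefreeI)
  fix p :: "int poly" assume "p ^ 2 dvd fib_poly n"
  then obtain q where q: "fib_poly n = p ^ 2 * q" by blast
  have p: "p dvd fib_poly n" unfolding q by (simp add: power2_eq_square)
  have "p dvd pderiv (fib_poly n)"
    unfolding q by (simp add: pderiv_mult power2_eq_square)
  then have "p dvd [:4, 0, 1:] * pderiv (fib_poly n) + of_nat (n + 1) * [:0, 1:] * fib_poly n"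
    using p by (intro dvd_add dvd_mult)
  then have "p dvd of_nat (2 * n) * fib_poly (Suc n)"
    unfolding pderiv_fib_poly by simp
  moreover have "comaximal p (fib_poly (Suc n))"
    using comaximal_mono[OF comaximal_fib_poly_Suc p dvd_refl] .
  ultimately have "p dvd of_nat (2 * n)" by (rule comaximal_dvd_multD[rotated])
  then have "p dvd [:int (2 * n):]" by (simp only: of_nat_poly)
  then show "is_unit p"
    using is_unit_if_dvd_monic_and_const[OF p monic_fib_poly[OF assms]] assms by simp
qed

subsection \<open>Fibotomic polynomials\<close>

lemma normalize_monic_int_poly:
  fixes p :: "int poly"
  shows "monic p \<Longrightarrow> normalize p = p"
  by (simp add: normalize_poly_eq_map_poly)

lemma monic_if_normalized_dvd_monic:
  fixes p q :: "int poly"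
  assumes "normalize p = p" and "p dvd q" and "monic q"
  shows "monic p"
proof -
  have "p \<noteq> 0" using assms(2,3) by auto
  then have "unit_factor p = 1" using assms(1) by (metis unit_factor_normalize)
  then have "coeff (unit_factor p) 0 = 1" by simp
  then have "sgn (lead_coeff p) = 1"
    by (simp add: unit_factor_poly_def)
  moreover have "lead_coeff p dvd 1"
    using assms(2,3) by (metis dvdE dvd_triv_left lead_coeff_mult)
  ultimately show ?thesis by (auto simp: sgn_if split: if_splits)
qed

lemma monic_irreducible_iff_prime:
  fixes p q :: "int poly"
  assumes "p dvd q" and "monic q"
  shows "monic p \<and> irreducible p \<longleftrightarrow> prime p"
  using monic_if_normalized_dvd_monic[OF _ assms] normalize_monic_int_poly[of p]
  by (auto simp: prime_def prime_elem_iff_irreducible)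

lemma normalize_prod_prime_factors_squarefree:
  fixes x :: "'a :: factorial_semiring"
  assumes "squarefree x"
  shows "normalize (\<Prod> (prime_factors x)) = normalize x"
proof -
  have "x \<noteq> 0" using assms by auto
  have "count (prime_factorization x) p = 1" if "p \<in> prime_factors x" for p
    using that assms \<open>x \<noteq> 0\<close>
    by (simp add: squarefree_factorial_semiring' count_prime_factorization_prime
        in_prime_factors_imp_prime)
  then have "\<Prod> (prime_factors x) = prod_mset (prime_factorization x)"
    by (simp add: prod_mset_multiplicity)
  then show ?thesis
    using prod_mset_prime_factorization_weak[OF \<open>x \<noteq> 0\<close>] by simp
qed

lemma fib_poly_eq_prod_prime_factors:
  assumes "n > 0"
  shows "fib_poly n = \<Prod> (prime_factors (fib_poly n))"
proof -
  have "monic p" if "p \<in> prime_factors (fib_poly n)" for p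
    using that monic_irreducible_iff_prime[OF _ monic_fib_poly[OF assms], of p] by auto
  then have "monic (\<Prod> (prime_factors (fib_poly n)))"
    by (simp add: lead_coeff_prod)
  then show ?thesis
    using normalize_prod_prime_factors_squarefree[OF squarefree_fib_poly[OF assms]]
    by (simp add: normalize_monic_int_poly monic_fib_poly[OF assms])
qed

text \<open>
  The rank of apparition; it is unspecified when \<open>p\<close> divides no \<open>F\<^sub>n\<close> with \<open>n > 0\<close>.
\<close>
definition fib_rank :: "int poly \<Rightarrow> nat" where
  "fib_rank p = (LEAST n. n > 0 \<and> p dvd fib_poly n)"

lemma fib_rank_le: "n > 0 \<Longrightarrow> p dvd fib_poly n \<Longrightarrow> fib_rank p \<le> n"
  unfolding fib_rank_def by (rule Least_le) simp

lemma fib_rank_dvd: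
  assumes "n > 0" and "p dvd fib_poly n"
  shows "fib_rank p dvd n" and "p dvd fib_poly (fib_rank p)"
proof -
  have rank: "fib_rank p > 0 \<and> p dvd fib_poly (fib_rank p)"
    unfolding fib_rank_def by (rule LeastI[of _ n]) (use assms in simp)
  then show "p dvd fib_poly (fib_rank p)" by blast
  have "fib_rank p \<le> gcd (fib_rank p) n"
    using rank assms by (intro fib_rank_le dvd_fib_poly_gcd) auto
  then have "gcd (fib_rank p) n = fib_rank p"
    using rank by (intro antisym) (auto intro: gcd_le1_nat)
  then show "fib_rank p dvd n" by (metis gcd_dvd2)
qed

lemma fib_rank_eq_iff:
  assumes "n > 0" and "p dvd fib_poly n"
  shows "fib_rank p = n \<longleftrightarrow> (\<forall>k\<in>{1..<n}. \<not> p dvd fib_poly k)"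
proof
  assume "\<forall>k\<in>{1..<n}. \<not> p dvd fib_poly k"
  then have "fib_rank p \<notin> {1..<n}"
    using fib_rank_dvd(2)[OF assms] by blast
  moreover have "fib_rank p > 0" "fib_rank p \<le> n"
    using fib_rank_dvd(1)[OF assms] assms(1) by (auto intro: dvd_pos_nat dvd_imp_le)
  ultimately show "fib_rank p = n" by auto
next
  assume "fib_rank p = n"
  show "\<forall>k\<in>{1..<n}. \<not> p dvd fib_poly k"
  proof (intro ballI notI)
    fix k assume "k \<in> {1..<n}" and "p dvd fib_poly k"
    then show False
      using fib_rank_le[of k p] \<open>fib_rank p = n\<close> by simp
  qed
qed

lemma fibotomic_eq_prod_prime_factors:
  assumes "n > 0"
  shows "fibotomic n = \<Prod> {p \<in> prime_factors (fib_poly n). fib_rank p = n}"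
proof (cases "n = 1")
  case True
  then show ?thesis by (simp add: fibotomic_def)
next
  case False
  have "{p. monic p \<and> irreducible p \<and> p dvd fib_poly n \<and> (\<forall>k\<in>{1..<n}. \<not> p dvd fib_poly k)} =
      {p \<in> prime_factors (fib_poly n). fib_rank p = n}"
    using monic_irreducible_iff_prime[OF _ monic_fib_poly[OF assms]] fib_rank_eq_iff[OF assms]
      fib_poly_nonzero[OF assms]
    by (auto simp: in_prime_factors_iff)
  then show ?thesis using False assms by (simp add: fibotomic_def)
qed

lemma fib_poly_eq_prod_fibotomic:
  assumes "n > 0"
  shows "fib_poly n = (\<Prod>d | d dvd n. fibotomic d)"
proof -
  let ?P = "\<lambda>n. prime_factors (fib_poly n)"
  have "fib_poly n = \<Prod> (?P n)"
    using assms by (rule fib_poly_eq_prod_prime_factors)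
  also have "\<dots> = (\<Prod>d | d dvd n. \<Prod> {p \<in> ?P n. fib_rank p = d})"
    using assms fib_rank_dvd(1)
    by (intro prod.group[symmetric]) (auto simp: in_prime_factors_iff)
  also have "\<dots> = (\<Prod>d | d dvd n. fibotomic d)"
  proof (rule prod.cong[OF refl])
    fix d assume "d \<in> {d. d dvd n}"
    then have d: "d dvd n" "d > 0" using assms by (auto intro: dvd_pos_nat)
    then have "{p \<in> ?P n. fib_rank p = d} = {p \<in> ?P d. fib_rank p = d}"
      using fib_rank_dvd(2)[OF assms] fib_poly_dvd[OF d(1)] fib_poly_nonzero assms
      by (auto simp: in_prime_factors_iff intro: dvd_trans)
    then show "\<Prod> {p \<in> ?P n. fib_rank p = d} = fibotomic d"
      by (simp add: fibotomic_eq_prod_prime_factors[OF d(2)])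
  qed
  finally show ?thesis .
qed

lemma monic_fibotomic: "monic (fibotomic n)"
  unfolding fibotomic_def by (auto simp: lead_coeff_prod intro!: prod.neutral)

lemma fibotomic_nonzero: "fibotomic n \<noteq> 0"
  using monic_fibotomic[of n] by auto

lemma fibotomic_dvd_fib_poly: "n > 0 \<Longrightarrow> fibotomic n dvd fib_poly n"
  by (subst fib_poly_eq_prod_fibotomic) (auto intro!: dvd_prodI)

lemma fibotomic_mult_dvd_fib_poly:
  assumes "a dvd n" "b dvd n" "a \<noteq> b" "n > 0"
  shows "fibotomic a * fibotomic b dvd fib_poly n"
proof -
  have "(\<Prod>d\<in>{a, b}. fibotomic d) dvd (\<Prod>d | d dvd n. fibotomic d)"
    using assms by (intro prod_dvd_prod_subset) auto
  then show ?thesis using assms by (simp add: fib_poly_eq_prod_fibotomic[of n])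
qed

lemma coprime_fibotomic:
  assumes "m \<noteq> n" "m > 0" "n > 0"
  shows "coprime (fibotomic m) (fibotomic n)"
proof (rule coprimeI)
  fix p assume "p dvd fibotomic m" "p dvd fibotomic n"
  then have "p\<^sup>2 dvd fibotomic m * fibotomic n"
    unfolding power2_eq_square by (rule mult_dvd_mono)
  also have "\<dots> dvd fib_poly (m * n)"
    using assms by (intro fibotomic_mult_dvd_fib_poly) auto
  finally have "p\<^sup>2 dvd fib_poly (m * n)" .
  with assms show "is_unit p"
    by (intro squarefreeD[OF squarefree_fib_poly, of "m * n"]) simp_all
qed

lemma divisor_sum_cancel:
  fixes f g :: "nat \<Rightarrow> 'a :: cancel_comm_monoid_add"
  assumes "\<And>n. n > 0 \<Longrightarrow> (\<Sum>d | d dvd n. f d) = (\<Sum>d | d dvd n. g d)" and "n > 0"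
  shows "f n = g n"
  using assms(2)
proof (induction n rule: less_induct)
  case (less n)
  have split: "(\<Sum>d | d dvd n. h d) = h n + (\<Sum>d\<in>{d. d dvd n} - {n}. h d)"
    for h :: "nat \<Rightarrow> 'a"
    using less.prems by (intro sum.remove) auto
  have "f d = g d" if "d \<in> {d. d dvd n} - {n}" for d
  proof -
    from that have "d dvd n" "d \<noteq> n" by auto
    then show ?thesis
      using less dvd_imp_le[of d n] dvd_pos_nat[of n d] by auto
  qed
  then have "(\<Sum>d\<in>{d. d dvd n} - {n}. f d) = (\<Sum>d\<in>{d. d dvd n} - {n}. g d)"
    by (rule sum.cong[OF refl])
  then show ?case
    using assms(1)[OF less.prems] unfolding split by simp
qed

lemma degree_fibotomic:
  assumes "n \<ge> 2"
  shows "degree (fibotomic n) = totient n"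
proof -
  have "degree (fibotomic n) + (if n = 1 then 1 else 0) = totient n"
  proof (rule divisor_sum_cancel[where g = totient])
    fix n :: nat assume n: "n > 0"
    have "(\<Sum>d | d dvd n. degree (fibotomic d)) = degree (\<Prod>d | d dvd n. fibotomic d)"
      by (rule degree_prod_eq_sum_degree[symmetric]) (simp add: fibotomic_nonzero)
    also have "\<dots> = n - 1"
      using fib_poly_eq_prod_fibotomic[OF n] degree_fib_poly[of n] by simp
    finally show "(\<Sum>d | d dvd n. degree (fibotomic d) + (if d = 1 then 1 else 0)) =
        (\<Sum>d | d dvd n. totient d)"
      using n by (simp add: sum.distrib totient_divisor_sum)
  qed (use assms in simp)
  then show ?thesis using assms by simp
qed

lemma hom_fibotomic_eq_homogenize:
  assumes "n \<ge> 2"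
  shows "hom_fibotomic n = homogenize (fibotomic n)"
  unfolding hom_fibotomic_def homogenize_def degree_fibotomic[OF assms]
  using assms by (intro if_not_P) linarith

lemma poly_fib_poly_Suc_Suc:
  fixes x :: "'a :: comm_ring_1"
  shows "poly (of_int_poly (fib_poly (Suc (Suc n)))) x =
    x * poly (of_int_poly (fib_poly (Suc n))) x + poly (of_int_poly (fib_poly n)) x"
  by (simp add: of_int_poly_hom.hom_add of_int_hom.map_poly_pCons_hom)

lemma poly_fib_poly_pos:
  fixes x :: "'a :: linordered_idom"
  assumes "x > 0"
  shows "poly (of_int_poly (fib_poly (Suc n))) x > 0"
proof (induction n rule: fib_poly.induct)
  case (3 n)
  then show ?case
    unfolding poly_fib_poly_Suc_Suc[of "Suc n"] using assms by (intro add_pos_pos mult_pos_pos)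
next
  case 2
  show ?case unfolding poly_fib_poly_Suc_Suc using assms by simp
qed simp

lemma poly_fib_poly_uminus:
  fixes x :: "'a :: comm_ring_1"
  shows "poly (of_int_poly (fib_poly n)) (- x) =
    (- 1) ^ Suc n * poly (of_int_poly (fib_poly n)) x"
proof (induction n rule: fib_poly.induct)
  case (3 n)
  then show ?case unfolding poly_fib_poly_Suc_Suc by (simp add: algebra_simps)
qed simp_all

lemma fib_poly_root_eq_0:
  fixes x :: "'a :: linordered_idom"
  assumes "n > 0" and root: "poly (of_int_poly (fib_poly n)) x = 0"
  shows "x = 0"
proof -
  have no_pos_root: "poly (of_int_poly (fib_poly n)) y \<noteq> 0" if "y > 0" for y :: 'a
    using poly_fib_poly_pos[OF that, of "n - 1"] assms(1) by simp
  have "poly (of_int_poly (fib_poly n)) (- x) = 0"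
    unfolding poly_fib_poly_uminus root by simp
  with root show ?thesis
    using no_pos_root[of x] no_pos_root[of "- x"] by linarith
qed

lemma fibotomic_2: "fibotomic 2 = [:0, 1:]"
proof -
  have "d dvd 2 \<longleftrightarrow> d = 1 \<or> d = 2" for d :: nat
    by (metis dvd_refl one_dvd prime_nat_iff two_is_prime_nat)
  then have "{d. d dvd 2} = {1, 2 :: nat}" by blast
  then have "fib_poly 2 = fibotomic 1 * fibotomic 2"
    using fib_poly_eq_prod_fibotomic[of 2] by simp
  also have "fibotomic 1 = 1" by (simp add: fibotomic_def)
  finally show ?thesis by (simp add: numeral_2_eq_2)
qed

lemma fibotomic_no_real_root:
  assumes "n \<ge> 3"
  shows "poly (of_int_poly (fibotomic n)) (x :: real) \<noteq> 0"
proof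
  assume root: "poly (of_int_poly (fibotomic n)) x = 0"
  obtain q where "fib_poly n = fibotomic n * q"
    using fibotomic_dvd_fib_poly[of n] assms by auto
  then have "poly (of_int_poly (fib_poly n)) x = 0"
    using root by (simp add: of_int_poly_hom.hom_mult)
  then have "x = 0" using fib_poly_root_eq_0[of n x] assms by simp
  with root have "poly (fibotomic n) 0 = 0"
    by (simp add: poly_0_coeff_0)
  then have "[:0, 1:] dvd fibotomic n"
    using poly_eq_0_iff_dvd[of "fibotomic n" 0] by simp
  then have "is_unit [:0, 1 :: int:]"
    using coprime_fibotomic[of 2 n] assms by (simp add: fibotomic_2 coprime_absorb_left)
  then show False by (simp add: is_unit_poly_iff)
qed

subsection \<open>Resultants of fibotomic polynomials\<close>

lemma resultant_fibotomic_nonneg: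
  assumes "n \<ge> 3"
  shows "resultant (fibotomic m) (fibotomic n) \<ge> 0"
proof -
  have "resultant (of_int_poly (fibotomic m)) (of_int_poly (fibotomic n)) \<ge> (0 :: real)"
    using fibotomic_no_real_root[OF assms] monic_fibotomic[of n]
    by (intro resultant_nonneg_if_no_real_root) auto
  then show ?thesis by (simp add: of_int_hom.resultant_hom)
qed

lemma fib_poly_eq_mult_prod_fibotomic:
  assumes "m dvd n" and "n > 0"
  shows "fib_poly n = fib_poly m * (\<Prod>d\<in>{d. d dvd n} - {d. d dvd m}. fibotomic d)"
proof -
  have "m > 0" using assms by (auto intro: dvd_pos_nat)
  have "{d. d dvd m} \<subseteq> {d. d dvd n}" using assms(1) by (auto intro: dvd_trans)
  then have "(\<Prod>d | d dvd n. fibotomic d) =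
      (\<Prod>d\<in>{d. d dvd n} - {d. d dvd m}. fibotomic d) * (\<Prod>d | d dvd m. fibotomic d)"
    using assms(2) by (intro prod.subset_diff) auto
  then show ?thesis
    by (simp add: fib_poly_eq_prod_fibotomic \<open>m > 0\<close> \<open>n > 0\<close> mult.commute)
qed

lemma fib_poly_mult_fibotomic_dvd:
  assumes "m dvd n" and "m \<noteq> n" and "n > 0"
  shows "fib_poly m * fibotomic n dvd fib_poly n"
proof -
  have "\<not> n dvd m" using assms dvd_antisym by blast
  then have "fibotomic n dvd (\<Prod>d\<in>{d. d dvd n} - {d. d dvd m}. fibotomic d)"
    using assms(3) by (intro dvd_prodI) auto
  then show ?thesis
    unfolding fib_poly_eq_mult_prod_fibotomic[OF assms(1,3)] by (rule mult_dvd_mono[OF dvd_refl])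
qed

lemma comaximal_fibotomic:
  assumes "m > 0" "n > 0" "\<not> m dvd n" "\<not> n dvd m"
  shows "comaximal (fibotomic m) (fibotomic n)"
proof -
  define g where "g = gcd m n"
  have g: "g dvd m" "g dvd n" "g > 0" using assms(1) by (simp_all add: g_def)
  then have "g \<noteq> m" "g \<noteq> n" using assms(3,4) by blast+
  obtain a b where a: "fib_poly m = fib_poly g * fibotomic m * a"
    and b: "fib_poly n = fib_poly g * fibotomic n * b"
    using fib_poly_mult_fibotomic_dvd[OF g(1) \<open>g \<noteq> m\<close> assms(1)]
      fib_poly_mult_fibotomic_dvd[OF g(2) \<open>g \<noteq> n\<close> assms(2)] by (auto elim!: dvdE)
  obtain u v where "u * fib_poly m + v * fib_poly n = fib_poly g"
    using fib_poly_bezout[of m n] unfolding g_def by blast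
  then have "fib_poly g * (u * a * fibotomic m + v * b * fibotomic n) = fib_poly g * 1"
    unfolding a b by (simp add: algebra_simps)
  then have "u * a * fibotomic m + v * b * fibotomic n = 1"
    using fib_poly_nonzero[OF g(3)] by (simp only: mult_cancel_left) simp
  then show ?thesis unfolding comaximal_def by blast
qed

lemma abs_resultant_fibotomic_quotient:
  assumes "m \<ge> 2" and "fib_poly (k * m) = fib_poly m * q"
  shows "\<bar>resultant (fibotomic m) q\<bar> = int k ^ totient m"
proof -
  let ?R = "resultant (fibotomic m)"
  have m: "m > 0" using assms by simp
  obtain q' where "fib_poly (k * m) = fib_poly m * q'"
    and "fib_poly m dvd q' - of_nat k * fib_poly (Suc m) ^ (k - 1)"
    by (rule fib_poly_mult_quotient)
  then have "fibotomic m dvd q - of_nat k * fib_poly (Suc m) ^ (k - 1)"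
    using assms(2) fib_poly_nonzero[OF m] fibotomic_dvd_fib_poly[OF m]
    by (metis dvd_trans mult_left_cancel)
  then have "?R q = ?R (of_nat k * fib_poly (Suc m) ^ (k - 1))"
    by (rule of_int_complex.resultant_cong_right[OF monic_fibotomic])
  also have "\<dots> = int k ^ totient m * ?R (fib_poly (Suc m)) ^ (k - 1)"
    unfolding of_int_complex.resultant_mult_right[OF monic_fibotomic]
      of_int_complex.resultant_power_right[OF monic_fibotomic]
    by (simp add: of_nat_poly degree_fibotomic[OF assms(1)])
  finally have "?R q = int k ^ totient m * ?R (fib_poly (Suc m)) ^ (k - 1)" .
  moreover have "\<bar>?R (fib_poly (Suc m))\<bar> = 1"
    using comaximal_mono[OF comaximal_fib_poly_Suc fibotomic_dvd_fib_poly[OF m] dvd_refl]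
    by (rule abs_resultant_comaximal[OF monic_fibotomic])
  ultimately show ?thesis by (simp add: abs_mult power_abs)
qed

lemma prod_abs_resultant_fibotomic_multiples:
  assumes "m \<ge> 2" and "k > 0"
  shows "(\<Prod>e\<in>{e. e dvd k} - {1}. \<bar>resultant (fibotomic m) (fibotomic (m * e))\<bar>) =
    int k ^ totient m"
proof -
  let ?R = "\<lambda>d. \<bar>resultant (fibotomic m) (fibotomic d)\<bar>"
  let ?S = "{d. d dvd k * m} - {d. d dvd m}"
  let ?M = "(*) m ` ({e. e dvd k} - {1})"
  have m: "m > 0" using assms by simp
  have "int k ^ totient m = \<bar>resultant (fibotomic m) (\<Prod>d\<in>?S. fibotomic d)\<bar>"
    using assms m
    by (intro abs_resultant_fibotomic_quotient[symmetric] fib_poly_eq_mult_prod_fibotomic) auto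
  also have "\<dots> = (\<Prod>d\<in>?S. ?R d)"
    by (simp add: of_int_complex.resultant_prod_right[OF monic_fibotomic] abs_prod)
  also have "\<dots> = (\<Prod>d\<in>?M. ?R d)"
  proof (rule prod.mono_neutral_right)
    show "finite ?S" using assms m by simp
    show "?M \<subseteq> ?S" using m by (auto simp: mult.commute)
    show "\<forall>d\<in>?S - ?M. ?R d = 1"
    proof
      fix d assume d: "d \<in> ?S - ?M"
      have "\<not> m dvd d"
      proof
        assume "m dvd d"
        then obtain e where "d = m * e" by blast
        with d m have "e dvd k" "e \<noteq> 1" by (auto simp: mult.commute)
        with \<open>d = m * e\<close> d show False by blast
      qed
      moreover have "d > 0" using d assms m by (auto intro: dvd_pos_nat)
      ultimately show "?R d = 1"
        using d m by (intro abs_resultant_comaximal monic_fibotomic comaximal_fibotomic) auto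
    qed
  qed
  also have "\<dots> = (\<Prod>e\<in>{e. e dvd k} - {1}. ?R (m * e))"
    using m by (subst prod.reindex) (auto simp: inj_on_def)
  finally show ?thesis by simp
qed

lemma resultant_fibotomic_multiple_pos:
  assumes "m \<ge> 2" and "k \<ge> 2"
  shows "resultant (fibotomic m) (fibotomic (m * k)) > 0"
proof -
  have "(\<Prod>e\<in>{e. e dvd k} - {1}. \<bar>resultant (fibotomic m) (fibotomic (m * e))\<bar>) \<noteq> 0"
    using prod_abs_resultant_fibotomic_multiples[of m k] assms by simp
  moreover have "finite ({e. e dvd k} - {1})" "k \<in> {e. e dvd k} - {1}" using assms(2) by auto
  ultimately have "resultant (fibotomic m) (fibotomic (m * k)) \<noteq> 0"
    by (metis (mono_tags, lifting) abs_eq_0 prod_zero_iff)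
  moreover have "3 \<le> m * k" using mult_le_mono[OF assms] by simp
  ultimately show ?thesis
    using resultant_fibotomic_nonneg[of "m * k" m] by linarith
qed

lemma ln_resultant_fibotomic_multiple:
  assumes "m \<ge> 2" and "k \<ge> 2"
  shows "ln (real_of_int (resultant (fibotomic m) (fibotomic (m * k)))) = totient m * mangoldt k"
proof -
  define r where "r e = real_of_int (resultant (fibotomic m) (fibotomic (m * e)))" for e
  define h where "h e = (if e = 1 then 0 else ln (r e))" for e
  have "h k = totient m * mangoldt k"
  proof (rule divisor_sum_cancel)
    fix k :: nat assume k: "k > 0"
    let ?D = "{e. e dvd k} - {1}"
    have r_pos: "r e > 0" if "e \<in> ?D" for e
    proof -
      have "e > 0" using that k by (auto intro: dvd_pos_nat)
      with that have "e \<ge> 2" by auto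
      then show ?thesis using resultant_fibotomic_multiple_pos[OF assms(1)] by (simp add: r_def)
    qed
    have "(\<Sum>e | e dvd k. h e) = (\<Sum>e\<in>?D. ln (r e))"
      using k by (intro sum.mono_neutral_cong_right) (auto simp: h_def)
    also have "\<dots> = ln (\<Prod>e\<in>?D. r e)"
      using r_pos k by (intro ln_prod[symmetric]) fastforce+
    also have "(\<Prod>e\<in>?D. r e) =
        real_of_int (\<Prod>e\<in>?D. \<bar>resultant (fibotomic m) (fibotomic (m * e))\<bar>)"
      using r_pos by (simp add: r_def less_imp_le)
    also have "\<dots> = real k ^ totient m"
      unfolding prod_abs_resultant_fibotomic_multiples[OF assms(1) k] by simp
    also have "ln \<dots> = (\<Sum>e | e dvd k. totient m * mangoldt e)"
      using k mangoldt_sum[of k, where ?'a = real]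
      by (simp add: ln_realpow flip: sum_distrib_left)
    finally show "(\<Sum>e | e dvd k. h e) = (\<Sum>e | e dvd k. totient m * mangoldt e)" .
  qed (use assms in simp)
  then show ?thesis using assms(2) by (simp add: h_def r_def)
qed

lemma resultant_fibotomic_multiple:
  assumes "m \<ge> 2" and "k \<ge> 2"
  shows "real_of_int (resultant (fibotomic m) (fibotomic (m * k))) = exp (totient m * mangoldt k)"
  using ln_resultant_fibotomic_multiple[OF assms] resultant_fibotomic_multiple_pos[OF assms]
  by (metis exp_ln of_int_0_less_iff)

lemma resultant_fibotomic_prime_power:
  assumes "m \<ge> 2" and "prime p" and "\<alpha> > 0"
  shows "resultant (fibotomic m) (fibotomic (m * p ^ \<alpha>)) = int p ^ totient m"
proof -
  have "p ^ \<alpha> \<ge> 2"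
    using assms(2,3) prime_ge_2_nat[of p] self_le_power[of p \<alpha>] by linarith
  then have "real_of_int (resultant (fibotomic m) (fibotomic (m * p ^ \<alpha>))) =
      exp (totient m * ln (real p))"
    using resultant_fibotomic_multiple[OF assms(1)] assms(2,3) by simp
  also have "\<dots> = real p ^ totient m"
    using prime_gt_0_nat[OF assms(2)] by (simp add: exp_of_nat_mult)
  finally show ?thesis by (metis of_int_eq_iff of_int_of_nat_eq of_int_power)
qed

lemma resultant_fibotomic_not_prime_power:
  assumes "m \<ge> 2" and "m < n" and "\<nexists>p \<alpha>. prime p \<and> \<alpha> > 0 \<and> n = m * p ^ \<alpha>"
  shows "resultant (fibotomic m) (fibotomic n) = 1"
proof (cases "m dvd n")
  case True
  then obtain k where k: "n = m * k" by blast
  then have "k \<noteq> 0" "k \<noteq> 1" using assms(2) by auto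
  then have "k \<ge> 2" by linarith
  have "\<not> primepow k" using assms(3) k unfolding primepow_def by blast
  then have "real_of_int (resultant (fibotomic m) (fibotomic n)) = 1"
    using resultant_fibotomic_multiple[OF assms(1) \<open>k \<ge> 2\<close>] by (simp add: k mangoldt_def)
  then show ?thesis by simp
next
  case False
  moreover have "\<not> n dvd m" using assms by (auto dest: dvd_imp_le)
  ultimately have "\<bar>resultant (fibotomic m) (fibotomic n)\<bar> = 1"
    using assms by (intro abs_resultant_comaximal monic_fibotomic comaximal_fibotomic) auto
  then show ?thesis using resultant_fibotomic_nonneg[of n m] assms by simp
qed

theorem theorem2:
  fixes m n :: nat
  assumes "2 \<le> m" and "m < n"
  shows "(\<forall>p \<alpha>. prime p \<and> \<alpha> > 0 \<and> n = m * p ^ \<alpha> \<longrightarrow>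
            resultant (hom_fibotomic m) (hom_fibotomic n) =
              monom (int p ^ totient m) (totient m * totient n))
       \<and> ((\<nexists>p \<alpha>. prime p \<and> \<alpha> > 0 \<and> n = m * p ^ \<alpha>) \<longrightarrow>
            resultant (hom_fibotomic m) (hom_fibotomic n) = monom 1 (totient m * totient n))"
proof -
  have "resultant (hom_fibotomic m) (hom_fibotomic n) =
      monom (resultant (fibotomic m) (fibotomic n)) (totient m * totient n)"
    using assms resultant_homogenize[of "fibotomic m" "fibotomic n"]
    by (simp add: hom_fibotomic_eq_homogenize degree_fibotomic)
  then show ?thesis
    using assms resultant_fibotomic_prime_power resultant_fibotomic_not_prime_power by metis
qed

end
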